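(* Let $\Gamma$ be a finite connected graph and let $A$ be a finite connected subgraph of $G=\mathbb{Z}\times\Gamma$. Fix a vertex $a\in A$ and an integer $d\ge1$. Let $\mathcal{S}=\{s_1,\dots,s_d\}$ and $r$ be integers such that $$\bar a<s_1<s_2<\dots<s_d<r\quad\text{and}\quad A\cap(\{r\}\times\Gamma)\neq\emptyset.$$ Let $S=(S_n)_{n\ge0}$ be the simple random walk on $A$ started from $a$, with law $\mathbb{P}^A_a$, let $H_r:=\min\{n\ge0:\bar S_n=r\}$, and let $$\mathcal{L}^r_{\mathcal{S}}:=|\{n\le H_r:\ \bar S_n\in\mathcal{S}\}|$$ be the total time spent on the levels of $\mathcal{S}$ before reaching level $r$. Then $$\mathbb{P}^A_a\left(\mathcal{L}^r_{\mathcal{S}}<k\right)\ \le\ \frac{|\Gamma|\sqrt{8k}}{d}\quad\text{for any } k\ge1.$$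
   Context: Graphs are nonempty, locally finite and undirected; $|\Gamma|$ is the number of vertices of $\Gamma$. $\mathbb{Z}\times\Gamma$ is the Cartesian product graph: $(i,\gamma)\sim(j,\gamma')$ iff ($i=j$ and $\gamma\sim\gamma'$ in $\Gamma$) or ($\gamma=\gamma'$ and $|i-j|=1$). For a vertex $a=(i,\gamma)$, $\bar a:=i$ is its level. The simple random walk on $A$ moves at each step to a uniformly chosen neighbor in $A$ of its current position, i.e. along the edges of $A$. *)

theory Defs
  imports "HOL-Probability.Probability" "Graph_Theory.Graph_Theory"
begin

text \<open>Finite simple graphs are \<^locale>\<open>pair_graph\<close>s: an undirected edge is a pair of opposite arcs,
  so the neighbours of \<open>v\<close> in \<open>A\<close> are the \<open>w\<close> with \<open>(v, w) \<in> parcs A\<close>.\<close>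

definition Z_times :: "'v pair_pre_digraph \<Rightarrow> (int \<times> 'v) pair_pre_digraph" where
  "Z_times \<Gamma> = \<lparr> pverts = UNIV \<times> pverts \<Gamma>,
     parcs = {((i, \<gamma>), (j, \<gamma>')). \<gamma> \<in> pverts \<Gamma> \<and> \<gamma>' \<in> pverts \<Gamma> \<and>
       (i = j \<and> (\<gamma>, \<gamma>') \<in> parcs \<Gamma> \<or> \<gamma> = \<gamma>' \<and> \<bar>i - j\<bar> = 1)} \<rparr>"

text \<open>A process \<open>S\<close> on a probability space \<open>M\<close> is a simple random walk on \<open>A\<close> from \<open>a\<close> if it starts at
  \<open>a\<close> and, given its past up to time \<open>n\<close>, its position at time \<open>n + 1\<close> is uniform on the neighbours
  of its current position. Conditional probabilities are multiplied out, so that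
  histories of probability \<open>0\<close> impose no condition. The uniform distribution on the empty set is
  unspecified, which matters only if \<open>a\<close> is isolated in \<open>A\<close>.\<close>

definition simple_random_walk ::
  "'w measure \<Rightarrow> 'a pair_pre_digraph \<Rightarrow> 'a \<Rightarrow> (nat \<Rightarrow> 'w \<Rightarrow> 'a) \<Rightarrow> bool" where
  "simple_random_walk M A a S \<longleftrightarrow>
     prob_space M \<and>
     (\<forall>n. S n \<in> M \<rightarrow>\<^sub>M count_space (pverts A)) \<and>
     (AE \<omega> in M. S 0 \<omega> = a) \<and>
     (\<forall>n x y.
        measure M {\<omega> \<in> space M. (\<forall>i\<le>n. S i \<omega> = x i) \<and> S (Suc n) \<omega> = y} =
        measure M {\<omega> \<in> space M. \<forall>i\<le>n. S i \<omega> = x i} *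
        pmf (pmf_of_set {w. (x n, w) \<in> parcs A}) y)"

text \<open>The level of a vertex of \<open>\<int> \<times> \<Gamma>\<close> is its first component. The hitting time is \<open>\<infinity>\<close> if level \<open>r\<close>
  is never reached.\<close>

definition hitting_time :: "(nat \<Rightarrow> 'w \<Rightarrow> int \<times> 'v) \<Rightarrow> int \<Rightarrow> 'w \<Rightarrow> enat" where
  "hitting_time S r \<omega> = (INF n \<in> {n. fst (S n \<omega>) = r}. enat n)"

definition time_on_levels ::
  "(nat \<Rightarrow> 'w \<Rightarrow> int \<times> 'v) \<Rightarrow> int set \<Rightarrow> int \<Rightarrow> 'w \<Rightarrow> enat" where
  "time_on_levels S L r \<omega> =
     (let T = {n. enat n \<le> hitting_time S r \<omega> \<and> fst (S n \<omega>) \<in> L}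
      in if finite T then enat (card T) else \<infinity>)"

end

theory Submission
  imports Defs
begin

text \<open>
  Let \<open>m\<close> be the number of vertices of \<open>\<Gamma>\<close> and \<open>N\<close> an integer with \<open>N \<le> k\<close> that bounds every
  visit count smaller than \<open>k\<close>. Discount the walk by a factor \<open>1 / (1 + \<kappa>)\<close> for each visit to a level
  in \<open>L = s ` {1..d}\<close>, and let \<open>h x\<close> be the expected discount collected before reaching level \<open>r\<close> from
  \<open>x\<close>. On the event in question the discount is at least \<open>(1 + \<kappa>) ^ -N\<close>, so by Markov's inequality its
  probability is at most \<open>(1 + \<kappa>) ^ N * h a\<close>, and with \<open>\<kappa> = 1 / N\<close> the first factor stays below \<open>e\<close>.
  It remains to see that \<open>h a\<close> is at most of order \<open>m * sqrt N / d\<close>.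

  Off level \<open>r\<close>, the function \<open>h\<close> solves the discrete Schroedinger equation
  \<open>\<Delta>h = \<kappa> * deg * h\<close> on the levels in \<open>L\<close> and \<open>\<Delta>h = 0\<close> elsewhere, where
  \<open>\<Delta>h x = (\<Sum>y\<in>nbrs x. h y - h x)\<close>. Testing the equation with
  \<open>h * above\<^sup>2\<close>, where \<open>above t\<close> counts the levels in \<open>L\<close> higher than \<open>t\<close>, and summing by
  parts (Caccioppoli's argument) costs \<open>h x * h y\<close> on each arc along which \<open>above\<close> changes, minus
  the Dirichlet energy of \<open>h * above\<close>. There is no boundary term because \<open>above r = 0\<close>, and the arcs
  that cost something are those that enter a level in \<open>L\<close> from below, at most one per vertex of that
  level. This gives \<open>energy_inequality\<close>:
  the sum of \<open>(\<kappa> * deg y * above\<^sup>2 - 1) * (h y)\<^sup>2\<close> over the vertices \<open>y\<close> on the levels in \<open>L\<close> is not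
  positive. The negative terms lie on the top \<open>1 / sqrt \<kappa>\<close> levels of \<open>L\<close> and are bounded with \<open>h \<le> 1\<close>.
  On every lower level the maximum principle (\<open>maximum_principle\<close>) provides a vertex with
  \<open>h y \<ge> h a\<close> and two neighbours, so these terms have size \<open>(h a)\<^sup>2\<close> times a cubic sum in \<open>d\<close>
  (\<open>decay_bound\<close>). Hence \<open>(h a)\<^sup>2 * d ^ 3 / N \<lesssim> m * sqrt N\<close>, and this
  implies \<open>h a \<lesssim> m * sqrt N / d\<close> as soon as \<open>d\<close> exceeds a multiple of \<open>sqrt N\<close>. In the remaining range
  \<open>d\<^sup>2 \<le> 8 * m\<^sup>2 * N\<close> the claimed bound is at least \<open>1\<close>. The constant \<open>8\<close> leaves little room for small
  \<open>d\<close>, and \<open>numeric_bound\<close> checks that it suffices.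

  Truncating at a finite time \<open>K\<close> replaces \<open>h\<close> by functions \<open>discounted_value\<close> that are defined by
  recursion on \<open>K\<close>, count unfinished walks with their current discount and decrease to \<open>h\<close>. The
  Markov bound holds for each \<open>K\<close>, so that walks that never reach level \<open>r\<close> are
  covered.
\<close>

section \<open>Finite subgraphs of the cylinder\<close>

text \<open>The graph \<open>A\<close> is the ambient graph of the locale, so that neighbours, degrees and connectivity refer
  to it and not to the cylinder; \<open>\<Gamma>\<close> determines the shape of the arcs and bounds the size of a level.\<close>

locale cylinder_subgraph = pair_graph A
  for A :: "(int \<times> 'v) pair_pre_digraph" +
  fixes \<Gamma> :: "'v pair_pre_digraph"
  assumes fibre: "pair_graph \<Gamma>"
    and connected_A: "connected A"
    and subgraph_A: "subgraph A (Z_times \<Gamma>)"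
begin

definition nbrs :: "int \<times> 'v \<Rightarrow> (int \<times> 'v) set" where
  "nbrs x = {y. (x, y) \<in> parcs A}"

abbreviation deg :: "int \<times> 'v \<Rightarrow> nat" where
  "deg x \<equiv> card (nbrs x)"

lemma nbrs_sym: "y \<in> nbrs x \<longleftrightarrow> x \<in> nbrs y"
  by (auto simp: nbrs_def dest: arcs_symmetric)

lemma nbrs_in_verts: "y \<in> nbrs x \<Longrightarrow> x \<in> pverts A \<and> y \<in> pverts A"
  by (auto simp: nbrs_def dest: in_arcsD1 in_arcsD2)

lemma finite_nbrs [simp]: "finite (nbrs x)"
  by (rule finite_subset[OF _ pair_finite_verts]) (use nbrs_in_verts in blast)

lemma nbrs_cases:
  assumes "y \<in> nbrs x"
  shows "fst y = fst x \<or> snd y = snd x \<and> (fst y = fst x + 1 \<or> fst x = fst y + 1)"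
proof -
  have "(x, y) \<in> parcs (Z_times \<Gamma>)"
    using assms subgraph_A by (auto simp: nbrs_def subgraph_def)
  then show ?thesis
    by (auto simp: Z_times_def)
qed

lemma nbrs_below_unique:
  assumes "y \<in> nbrs x" "y' \<in> nbrs x" "fst x = fst y + 1" "fst x = fst y' + 1"
  shows "y = y'"
  using nbrs_cases[OF assms(1)] nbrs_cases[OF assms(2)] assms(3,4) by (auto intro: prod_eqI)

lemma card_level_le: "card {x \<in> pverts A. fst x = i} \<le> card (pverts \<Gamma>)"
proof -
  interpret G: pair_graph \<Gamma> by (rule fibre)
  have "pverts A \<subseteq> UNIV \<times> pverts \<Gamma>"
    using subgraph_A by (auto simp: subgraph_def Z_times_def)
  then have "{x \<in> pverts A. fst x = i} \<subseteq> {i} \<times> pverts \<Gamma>"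
    by auto
  then have "card {x \<in> pverts A. fst x = i} \<le> card ({i} \<times> pverts \<Gamma>)"
    by (intro card_mono) (auto simp: G.pair_finite_verts)
  then show ?thesis by (simp add: card_cartesian_product)
qed

text \<open>This is the form in which connectivity is used: it turns local propagation, such as that of a
  maximum to all neighbours, into a statement about the whole graph.\<close>

lemma closed_under_nbrs_eq_verts:
  assumes "C \<noteq> {}" "C \<subseteq> pverts A" and closed: "\<And>x y. x \<in> C \<Longrightarrow> y \<in> nbrs x \<Longrightarrow> y \<in> C"
  shows "C = pverts A"
proof -
  obtain x where x: "x \<in> C" using assms(1) by blast
  have "strongly_connected A"
    using symmetric_connected_imp_strongly_connected pair_sym_arcs connected_A by blast
  then have reach: "x \<rightarrow>\<^sup>*\<^bsub>A\<^esub> y" if "y \<in> pverts A" for y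
    using that x assms(2) by (auto simp: strongly_connected_def)
  have "y \<in> C" if "x \<rightarrow>\<^sup>*\<^bsub>A\<^esub> y" for y
    using that x
  proof (induct rule: reachable_induct)
    case (step u v)
    then show ?case using closed by (auto simp: nbrs_def)
  qed auto
  with reach show ?thesis using assms(2) by blast
qed

lemma nbrs_nonempty:
  assumes "x \<in> pverts A" "y \<in> pverts A" "x \<noteq> y"
  shows "nbrs x \<noteq> {}"
  using closed_under_nbrs_eq_verts[of "{x}"] assms by auto

lemma sum_over_arcs:
  fixes f :: "int \<times> 'v \<Rightarrow> int \<times> 'v \<Rightarrow> real"
  shows "(\<Sum>x\<in>pverts A. \<Sum>y\<in>nbrs x. f x y) = (\<Sum>(x, y)\<in>parcs A. f x y)"
proof -
  have "Sigma (pverts A) nbrs = parcs A"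
    using nbrs_in_verts by (auto simp: nbrs_def)
  then show ?thesis
    by (subst sum.Sigma) (auto simp: pair_finite_verts)
qed

lemma sum_arcs_swap:
  fixes f :: "int \<times> 'v \<Rightarrow> int \<times> 'v \<Rightarrow> real"
  shows "(\<Sum>(x, y)\<in>parcs A. f x y) = (\<Sum>(x, y)\<in>parcs A. f y x)"
  by (rule sum.reindex_bij_witness[of _ prod.swap prod.swap]) (auto dest: arcs_symmetric)

end

section \<open>A weighted energy estimate\<close>

text \<open>When the weight drops from \<open>i + 1\<close> to \<open>i\<close> along an arc from value \<open>s\<close> to value \<open>u\<close>, the cost
  \<open>s * u\<close> is not bounded by \<open>u\<^sup>2\<close> alone, since nothing prevents \<open>s\<close> from being larger than \<open>u\<close>. The
  Dirichlet energy of the arc pays for the excess: the difference of the two sides is a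
  sum of squares in \<open>u\<close> and \<open>s - u\<close>.\<close>

lemma jump_cost:
  fixes i s u :: real
  assumes "i \<ge> 0"
  shows "s * u - ((i + 1) * s - i * u)\<^sup>2 \<le> u\<^sup>2"
proof -
  have "4 * (u\<^sup>2 - (s * u - ((i + 1) * s - i * u)\<^sup>2))
      = (2 * u + (2 * i + 1) * (s - u))\<^sup>2 + (4 * i + 3) * (s - u)\<^sup>2"
    by (simp add: power2_eq_square algebra_simps)
  also have "\<dots> \<ge> 0"
    using assms by (intro add_nonneg_nonneg mult_nonneg_nonneg) auto
  finally show ?thesis
    by simp
qed

text \<open>Numbering the elements of \<open>L\<close> from the top turns sums over levels into sums over an initial
  segment of the natural numbers.\<close>

lemma sum_over_upper_ranks:
  fixes f :: "nat \<Rightarrow> real" and L :: "int set"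
  assumes "finite L"
  shows "(\<Sum>\<sigma>\<in>L. f (card {\<tau> \<in> L. \<sigma> < \<tau>})) = (\<Sum>i<card L. f i)"
  using assms
proof (induction L rule: finite_linorder_min_induct)
  case (insert b A)
  have b: "b \<notin> A" using insert.hyps by auto
  have "{\<tau> \<in> insert b A. b < \<tau>} = A" using insert.hyps by auto
  moreover have "{\<tau> \<in> insert b A. \<sigma> < \<tau>} = {\<tau> \<in> A. \<sigma> < \<tau>}" if "\<sigma> \<in> A" for \<sigma>
    using insert.hyps that by force
  ultimately show ?case
    using b insert.IH insert.hyps(1) by simp
qed simp

text \<open>The equation \<open>h_eq\<close> says that \<open>h x\<close> is the average of \<open>h\<close> over the neighbours of \<open>x\<close>, divided by
  \<open>1 + \<kappa>\<close> on the levels in \<open>L\<close>. It is multiplied by the degree because the sum over arcs of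
  \<open>h y - h x\<close> can then be symmetrised in the two ends.\<close>

locale killed_harmonic = cylinder_subgraph A \<Gamma>
  for A :: "(int \<times> 'v) pair_pre_digraph" and \<Gamma> :: "'v pair_pre_digraph" +
  fixes L :: "int set" and r :: int and \<kappa> :: real and h :: "int \<times> 'v \<Rightarrow> real"
  assumes finite_L: "finite L"
    and L_below: "\<And>\<sigma>. \<sigma> \<in> L \<Longrightarrow> \<sigma> < r"
    and kappa_pos: "\<kappa> > 0"
    and h_range: "\<And>x. 0 \<le> h x \<and> h x \<le> 1"
    and h_eq: "\<And>x. x \<in> pverts A \<Longrightarrow> fst x \<noteq> r \<Longrightarrow>
      (\<Sum>y\<in>nbrs x. h y) = (1 + \<kappa> * of_bool (fst x \<in> L)) * real (deg x) * h x"
begin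

definition above :: "int \<Rightarrow> real" where
  "above t = real (card {\<sigma> \<in> L. t < \<sigma>})"

lemma above_nonneg: "0 \<le> above t" by (simp add: above_def)

lemma above_target: "above r = 0"
proof -
  have "{\<sigma> \<in> L. r < \<sigma>} = {}" using L_below by force
  then show ?thesis by (simp only: above_def) simp
qed

lemma above_step: "above t = above (t + 1) + of_bool (t + 1 \<in> L)"
proof -
  have "{\<sigma> \<in> L. t < \<sigma>} = (if t + 1 \<in> L then insert (t + 1) {\<sigma> \<in> L. t + 1 < \<sigma>} else {\<sigma> \<in> L. t + 1 < \<sigma>})"
  proof -
    have *: "\<And>\<sigma>. t < \<sigma> \<longleftrightarrow> \<sigma> = t + 1 \<or> t + 1 < \<sigma>" by auto
    show ?thesis by (auto simp: *)
  qed
  then show ?thesis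
    using finite_L by (simp add: above_def)
qed

definition down_arc :: "int \<times> 'v \<Rightarrow> int \<times> 'v \<Rightarrow> bool" where
  "down_arc x y \<longleftrightarrow> fst x = fst y + 1 \<and> fst x \<in> L"

text \<open>The left-hand side is what an arc contributes to the summation by parts. The weight jumps only
  when the upper end of the arc lies on a level in \<open>L\<close>, and the cost is charged to this end, where
  the discount is strong enough to absorb it.\<close>

lemma arc_cost:
  assumes "y \<in> nbrs x"
  shows "h x * h y * (above (fst x) - above (fst y))\<^sup>2 - (h x * above (fst x) - h y * above (fst y))\<^sup>2
    \<le> of_bool (down_arc x y) * (h x)\<^sup>2 + of_bool (down_arc y x) * (h y)\<^sup>2"
proof -
  consider "fst y = fst x" | "fst y = fst x + 1" | "fst x = fst y + 1"
    using nbrs_cases[OF assms] by auto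
  then show ?thesis
  proof cases
    case 1
    then show ?thesis by (simp add: down_arc_def)
  next
    case 2
    then have "above (fst x) = above (fst y) + of_bool (fst y \<in> L)"
      using above_step[of "fst x"] by (simp only:)
    moreover have "\<not> down_arc x y" using 2 by (simp add: down_arc_def)
    ultimately show ?thesis
      using jump_cost[OF above_nonneg[of "fst y"], where s = "h x" and u = "h y"] 2
      by (cases "fst y \<in> L") (simp_all add: down_arc_def mult.commute)
  next
    case 3
    then have "above (fst y) = above (fst x) + of_bool (fst x \<in> L)"
      using above_step[of "fst y"] by (simp only:)
    moreover have "\<not> down_arc y x" using 3 by (simp add: down_arc_def)
    ultimately show ?thesis
      using jump_cost[OF above_nonneg[of "fst x"], where s = "h y" and u = "h x"] 3
      by (cases "fst x \<in> L") (simp_all add: down_arc_def mult.commute power2_commute)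
  qed
qed

text \<open>This is the equation for \<open>h\<close> tested with \<open>h * above\<^sup>2\<close>. After symmetrisation in the two ends of an
  arc, the identity
  \<open>(h y - h x) * (h x * p\<^sup>2 - h y * q\<^sup>2) = h x * h y * (p - q)\<^sup>2 - (h x * p - h y * q)\<^sup>2\<close>
  isolates the part due to the variation of the weight.\<close>

lemma energy_inequality:
  "(\<Sum>x | x \<in> pverts A \<and> fst x \<in> L. (\<kappa> * deg x * (above (fst x))\<^sup>2 - 1) * (h x)\<^sup>2) \<le> 0"
proof -
  let ?V = "pverts A" and ?f = "\<lambda>x. above (fst x)"
  define mass where "mass = (\<Sum>x\<in>?V. \<kappa> * of_bool (fst x \<in> L) * deg x * (?f x)\<^sup>2 * (h x)\<^sup>2)"
  have "mass = (\<Sum>x\<in>?V. \<Sum>y\<in>nbrs x. h x * (?f x)\<^sup>2 * (h y - h x))"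
    unfolding mass_def
  proof (rule sum.cong[OF refl])
    fix x assume x: "x \<in> ?V"
    show "\<kappa> * of_bool (fst x \<in> L) * deg x * (?f x)\<^sup>2 * (h x)\<^sup>2 =
      (\<Sum>y\<in>nbrs x. h x * (?f x)\<^sup>2 * (h y - h x))"
    proof (cases "fst x = r")
      case True
      then show ?thesis by (simp add: above_target)
    next
      case False
      then have "(\<Sum>y\<in>nbrs x. h y - h x) = \<kappa> * of_bool (fst x \<in> L) * real (deg x) * h x"
        using h_eq[OF x] by (simp add: sum_subtractf algebra_simps)
      moreover have "(\<Sum>y\<in>nbrs x. h x * (?f x)\<^sup>2 * (h y - h x)) = h x * (?f x)\<^sup>2 * (\<Sum>y\<in>nbrs x. h y - h x)"
        by (simp only: sum_distrib_left)
      ultimately show ?thesis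
        by (simp add: power2_eq_square mult.assoc mult.left_commute)
    qed
  qed
  also have "\<dots> = (\<Sum>(x, y)\<in>parcs A. h x * (?f x)\<^sup>2 * (h y - h x))"
    by (rule sum_over_arcs)
  finally have mass_arcs: "mass = (\<Sum>(x, y)\<in>parcs A. h x * (?f x)\<^sup>2 * (h y - h x))" .
  have "2 * mass = (\<Sum>(x, y)\<in>parcs A. h x * (?f x)\<^sup>2 * (h y - h x))
      + (\<Sum>(x, y)\<in>parcs A. h y * (?f y)\<^sup>2 * (h x - h y))"
    using mass_arcs sum_arcs_swap[of "\<lambda>x y. h x * (?f x)\<^sup>2 * (h y - h x)"] by simp
  also have "\<dots> = (\<Sum>(x, y)\<in>parcs A. h x * h y * (?f x - ?f y)\<^sup>2 - (h x * ?f x - h y * ?f y)\<^sup>2)"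
    by (subst sum.distrib[symmetric], rule sum.cong)
       (auto simp: power2_eq_square algebra_simps)
  also have "\<dots> \<le> (\<Sum>(x, y)\<in>parcs A. of_bool (down_arc x y) * (h x)\<^sup>2 + of_bool (down_arc y x) * (h y)\<^sup>2)"
    by (rule sum_mono) (use arc_cost in \<open>auto simp: nbrs_def\<close>)
  also have "\<dots> = 2 * (\<Sum>(x, y)\<in>parcs A. of_bool (down_arc x y) * (h x)\<^sup>2)"
    using sum_arcs_swap[of "\<lambda>x y. of_bool (down_arc x y) * (h x)\<^sup>2"]
    by (simp add: case_prod_unfold sum.distrib)
  also have "(\<Sum>(x, y)\<in>parcs A. of_bool (down_arc x y) * (h x)\<^sup>2)
      = (\<Sum>x\<in>?V. \<Sum>y\<in>nbrs x. of_bool (down_arc x y) * (h x)\<^sup>2)"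
    by (rule sum_over_arcs[symmetric])
  also have "\<dots> \<le> (\<Sum>x\<in>?V. of_bool (fst x \<in> L) * (h x)\<^sup>2)"
  proof (rule sum_mono)
    fix x assume "x \<in> ?V"
    have "card (nbrs x \<inter> {y. down_arc x y}) \<le> of_bool (fst x \<in> L)"
    proof (cases "fst x \<in> L")
      case True
      have "card (nbrs x \<inter> {y. down_arc x y}) \<le> Suc 0"
        using nbrs_below_unique by (subst card_le_Suc0_iff_eq) (simp, unfold down_arc_def, blast)
      then show ?thesis using True by simp
    qed (simp add: down_arc_def)
    then have "(\<Sum>y\<in>nbrs x. of_bool (down_arc x y)) \<le> (of_bool (fst x \<in> L) :: real)"
      by (cases "fst x \<in> L") simp_all
    then show "(\<Sum>y\<in>nbrs x. of_bool (down_arc x y) * (h x)\<^sup>2) \<le> of_bool (fst x \<in> L) * (h x)\<^sup>2"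
      by (simp add: sum_distrib_right[symmetric] mult_right_mono)
  qed
  finally have "mass \<le> (\<Sum>x\<in>?V. of_bool (fst x \<in> L) * (h x)\<^sup>2)" by simp
  then have "(\<Sum>x\<in>?V. of_bool (fst x \<in> L) * ((\<kappa> * deg x * (?f x)\<^sup>2 - 1) * (h x)\<^sup>2)) \<le> 0"
    by (simp add: mass_def sum_subtractf[symmetric] algebra_simps)
       (simp add: sum_subtractf)
  also have "(\<Sum>x\<in>?V. of_bool (fst x \<in> L) * ((\<kappa> * deg x * (?f x)\<^sup>2 - 1) * (h x)\<^sup>2))
      = (\<Sum>x | x \<in> ?V \<and> fst x \<in> L. (\<kappa> * deg x * (?f x)\<^sup>2 - 1) * (h x)\<^sup>2)"
    by (rule sum.mono_neutral_cong_right) (auto simp: pair_finite_verts)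
  finally show ?thesis .
qed

text \<open>Since \<open>h\<close> is subharmonic off level \<open>r\<close>, its maximum over the part of the graph below level \<open>\<sigma>\<close>
  is attained where this part can be left towards level \<open>r\<close>. Dead ends on level \<open>\<sigma>\<close> are counted as
  belonging to the lower part, so the exit vertices have a neighbour below and another one. The
  resulting degree of at least \<open>2\<close> doubles the main term of the energy inequality; without
  this factor the estimate would not reach the constant \<open>8\<close> when \<open>\<Gamma>\<close> is a single vertex.\<close>

lemma maximum_principle:
  assumes a: "a \<in> pverts A" "fst a < \<sigma>" and target: "b \<in> pverts A" "fst b = r" and \<sigma>: "\<sigma> \<in> L"
  shows "\<exists>y \<in> pverts A. fst y = \<sigma> \<and> deg y \<ge> 2 \<and> h a \<le> h y"
proof (rule ccontr)
  assume "\<not> ?thesis"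
  then have low: "h y < h a" if "y \<in> pverts A" "fst y = \<sigma>" "deg y \<ge> 2" for y
    using that linorder_not_le by blast
  \<comment> \<open>The second alternative adds the dead ends of level \<open>\<sigma>\<close>.\<close>
  define W where "W = {x \<in> pverts A. fst x < \<sigma> \<or> fst x = \<sigma> \<and> (\<forall>y\<in>nbrs x. fst y < \<sigma>)}"
  define \<mu> where "\<mu> = Max (h ` W)"
  define C where "C = {x \<in> W. h x = \<mu>}"
  have fin: "finite (h ` W)" by (simp add: W_def pair_finite_verts)
  have aW: "a \<in> W" using a by (simp add: W_def)
  have le: "h x \<le> \<mu>" if "x \<in> W" for x
    using that fin by (simp add: \<mu>_def)
  have ne: "C \<noteq> {}"
  proof -
    have "\<mu> \<in> h ` W" using Max_in[OF fin] aW unfolding \<mu>_def by blast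
    then show ?thesis by (auto simp: C_def)
  qed
  have CV: "C \<subseteq> pverts A" unfolding C_def W_def by blast
  have exit: "y \<in> W \<or> h y < \<mu>" if "x \<in> W" "y \<in> nbrs x" for x y
  proof (rule disjCI)
    assume "\<not> h y < \<mu>"
    then have ge: "h a \<le> h y" using le[OF aW] by simp
    have yV: "y \<in> pverts A" using nbrs_in_verts that by blast
    show "y \<in> W"
    proof (cases "fst y < \<sigma>")
      case True
      then show ?thesis using yV by (simp add: W_def)
    next
      case False
      then have x: "fst x < \<sigma>" using that by (auto simp: W_def)
      then have y: "fst y = \<sigma>" using nbrs_cases[OF that(2)] False by auto
      have "\<not> 2 \<le> deg y" using low[OF yV y] ge by auto
      then have "card (nbrs y) \<le> Suc 0" by simp
      then have "\<forall>z\<in>nbrs y. z = x"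
        using that(2) nbrs_sym card_le_Suc0_iff_eq[OF finite_nbrs] by blast
      then show ?thesis using x y yV by (auto simp: W_def)
    qed
  qed
  have closed: "y \<in> C" if "x \<in> C" "y \<in> nbrs x" for x y
  proof -
    have x: "x \<in> W" "h x = \<mu>" "x \<in> pverts A" using that by (auto simp: C_def W_def)
    have nb: "h z \<le> \<mu>" if "z \<in> nbrs x" for z
      using exit[OF x(1) that] le less_imp_le by blast
    have "fst x \<noteq> r" using x(1) L_below[OF \<sigma>] by (auto simp: W_def)
    then have "(\<Sum>z\<in>nbrs x. h z) = (1 + \<kappa> * of_bool (fst x \<in> L)) * (deg x * \<mu>)"
      using h_eq x by simp
    moreover have "deg x * \<mu> \<le> (1 + \<kappa> * of_bool (fst x \<in> L)) * (deg x * \<mu>)"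
      using mult_right_mono[of 1 "1 + \<kappa> * of_bool (fst x \<in> L)" "deg x * \<mu>"] kappa_pos h_range[of x] x
      by simp
    ultimately have "(\<Sum>z\<in>nbrs x. \<mu> - h z) \<le> 0"
      by (simp add: sum_subtractf)
    moreover have "\<mu> - h y \<le> (\<Sum>z\<in>nbrs x. \<mu> - h z)"
      using nb that(2) by (intro member_le_sum) auto
    ultimately have "h y = \<mu>"
      using nb[OF that(2)] by simp
    then show ?thesis using exit[OF x(1) that(2)] by (auto simp: C_def)
  qed
  have "C = pverts A"
    using ne CV closed by (rule closed_under_nbrs_eq_verts)
  then have "b \<in> C" using target by simp
  then have "b \<in> W" by (simp add: C_def)
  then have "fst b \<le> \<sigma>" unfolding W_def by (elim CollectE conjE disjE) simp_all
  then show False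
    using target L_below[OF \<sigma>] by simp
qed

text \<open>A level where \<open>\<kappa> * above\<^sup>2 \<ge> 1\<close> has only nonnegative terms, and the vertex given by the maximum
  principle contributes the first summand. On the remaining levels each of the at most
  \<open>card (pverts \<Gamma>)\<close> terms is at least \<open>-1\<close>; the first summand is kept there as well, so that the sum
  over all levels has a closed form.\<close>

lemma level_lower_bound:
  assumes a: "a \<in> pverts A" "fst a < \<sigma>" and target: "b \<in> pverts A" "fst b = r" and \<sigma>: "\<sigma> \<in> L"
  shows "(h a)\<^sup>2 * (2 * \<kappa> * (above \<sigma>)\<^sup>2 - 1) - card (pverts \<Gamma>) * of_bool (\<kappa> * (above \<sigma>)\<^sup>2 < 1)
    \<le> (\<Sum>x | x \<in> pverts A \<and> fst x = \<sigma>. (\<kappa> * deg x * (above \<sigma>)\<^sup>2 - 1) * (h x)\<^sup>2)"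
proof -
  let ?V = "{x \<in> pverts A. fst x = \<sigma>}" and ?q = "\<kappa> * (above \<sigma>)\<^sup>2"
  define g where "g x = (\<kappa> * deg x * (above \<sigma>)\<^sup>2 - 1) * (h x)\<^sup>2" for x
  have fin: "finite ?V" by (simp add: pair_finite_verts)
  have q: "?q \<ge> 0" using kappa_pos by simp
  obtain y where y: "y \<in> ?V" "deg y \<ge> 2" "h a \<le> h y"
    using maximum_principle[OF a target \<sigma>] by auto
  have g_y: "(h a)\<^sup>2 * (2 * ?q - 1) \<le> g y" if "2 * ?q \<ge> 1"
  proof -
    have "(h a)\<^sup>2 * (2 * ?q - 1) \<le> (h y)\<^sup>2 * (2 * ?q - 1)"
      using that y(3) h_range by (intro mult_right_mono power_mono) auto
    also have "\<dots> \<le> (h y)\<^sup>2 * (real (deg y) * ?q - 1)"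
      using y(2) q by (intro mult_left_mono diff_right_mono mult_right_mono) auto
    finally show ?thesis by (simp add: g_def algebra_simps)
  qed
  have g_ge: "-1 \<le> g x" for x
  proof -
    have "-1 \<le> - ((h x)\<^sup>2)" using h_range[of x] by (simp add: power_le_one)
    also have "\<dots> \<le> \<kappa> * deg x * (above \<sigma>)\<^sup>2 * (h x)\<^sup>2 - (h x)\<^sup>2"
      using kappa_pos by simp
    also have "\<dots> = g x"
      by (simp add: g_def algebra_simps)
    finally show ?thesis .
  qed
  have sum_ge: "- real (card (pverts \<Gamma>)) \<le> (\<Sum>x\<in>X. g x)" if "X \<subseteq> ?V" for X
  proof -
    have "card X \<le> card (pverts \<Gamma>)"
      using card_mono[OF fin that] card_level_le[of \<sigma>] by linarith
    then have "- real (card (pverts \<Gamma>)) \<le> (\<Sum>x\<in>X. -1)"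
      by simp
    also have "\<dots> \<le> (\<Sum>x\<in>X. g x)" by (intro sum_mono g_ge)
    finally show ?thesis .
  qed
  have split: "(\<Sum>x\<in>?V. g x) = g y + (\<Sum>x\<in>?V - {y}. g x)"
    by (rule sum.remove[OF fin y(1)])
  have "(h a)\<^sup>2 * (2 * ?q - 1) - card (pverts \<Gamma>) * of_bool (?q < 1) \<le> (\<Sum>x\<in>?V. g x)"
  proof (cases "?q < 1")
    case True
    show ?thesis
    proof (cases "2 * ?q \<ge> 1")
      case True
      then show ?thesis
        using g_y sum_ge[of "?V - {y}"] split \<open>?q < 1\<close> by simp
    next
      case False
      then have "(h a)\<^sup>2 * (2 * ?q - 1) \<le> 0"
        by (intro mult_nonneg_nonpos) auto
      then show ?thesis using sum_ge[of ?V] \<open>?q < 1\<close> by simp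
    qed
  next
    case False
    have "0 \<le> g x" if "x \<in> ?V" for x
    proof -
      have "nbrs x \<noteq> {}"
        using that a by (intro nbrs_nonempty[of x a]) auto
      then have "1 \<le> deg x"
        by (simp add: Suc_le_eq card_gt_0_iff)
      then have "1 * 1 \<le> real (deg x) * ?q"
        using False by (intro mult_mono) auto
      then have "0 \<le> (real (deg x) * ?q - 1) * (h x)\<^sup>2"
        by (intro mult_nonneg_nonneg) auto
      then show ?thesis
        by (simp add: g_def ac_simps)
    qed
    then have "0 \<le> (\<Sum>x\<in>?V - {y}. g x)" by (intro sum_nonneg) auto
    then show ?thesis using g_y split False by simp
  qed
  then show ?thesis by (simp add: g_def mult.assoc)
qed

lemma decay_bound:
  assumes a: "a \<in> pverts A" "\<And>\<sigma>. \<sigma> \<in> L \<Longrightarrow> fst a < \<sigma>" and target: "b \<in> pverts A" "fst b = r"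
  shows "(h a)\<^sup>2 * (\<Sum>i<card L. 2 * \<kappa> * (real i)\<^sup>2 - 1)
    \<le> real (card (pverts \<Gamma>)) * card {i. i < card L \<and> \<kappa> * (real i)\<^sup>2 < 1}"
proof -
  let ?m = "real (card (pverts \<Gamma>))"
  define g where "g x = (\<kappa> * deg x * (above (fst x))\<^sup>2 - 1) * (h x)\<^sup>2" for x
  define f where "f i = (h a)\<^sup>2 * (2 * \<kappa> * (real i)\<^sup>2 - 1) - ?m * of_bool (\<kappa> * (real i)\<^sup>2 < 1)" for i
  have "(\<Sum>i<card L. f i) = (\<Sum>\<sigma>\<in>L. f (card {\<tau> \<in> L. \<sigma> < \<tau>}))"
    by (rule sum_over_upper_ranks[OF finite_L, symmetric])
  also have "\<dots> \<le> (\<Sum>\<sigma>\<in>L. \<Sum>x | x \<in> pverts A \<and> fst x = \<sigma>. g x)"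
  proof (rule sum_mono)
    fix \<sigma> assume \<sigma>: "\<sigma> \<in> L"
    show "f (card {\<tau> \<in> L. \<sigma> < \<tau>}) \<le> (\<Sum>x | x \<in> pverts A \<and> fst x = \<sigma>. g x)"
      using level_lower_bound[OF a(1) a(2)[OF \<sigma>] target \<sigma>]
      by (simp add: f_def g_def above_def)
  qed
  also have "\<dots> = (\<Sum>\<sigma>\<in>L. \<Sum>x | x \<in> {x. x \<in> pverts A \<and> fst x \<in> L} \<and> fst x = \<sigma>. g x)"
    by (intro sum.cong) auto
  also have "\<dots> = (\<Sum>x | x \<in> pverts A \<and> fst x \<in> L. g x)"
    by (rule sum.group) (auto simp: pair_finite_verts finite_L)
  also have "\<dots> \<le> 0"
    using energy_inequality by (simp add: g_def)
  finally have "(\<Sum>i<card L. f i) \<le> 0" .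
  moreover have "{..<card L} \<inter> {i. \<kappa> * (real i)\<^sup>2 < 1} = {i. i < card L \<and> \<kappa> * (real i)\<^sup>2 < 1}"
    by auto
  ultimately show ?thesis
    by (simp add: f_def sum_subtractf sum_distrib_left[symmetric])
qed

end

section \<open>The numerical inequality\<close>

lemma sum_squares_minus_one:
  fixes N :: real
  assumes "N > 0"
  shows "N * (\<Sum>i<d. 2 * (1 / N) * (real i)\<^sup>2 - 1) = (real d - 1) * d * (2 * real d - 1) / 3 - d * N"
proof -
  have "N * (\<Sum>i<d. 2 * (1 / N) * (real i)\<^sup>2 - 1) = (\<Sum>i<d. 2 * (real i)\<^sup>2 - N)"
    using assms by (simp add: sum_distrib_left right_diff_distrib)
  also have "\<dots> = (real d - 1) * d * (2 * real d - 1) / 3 - d * N"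
    by (induction d) (auto simp: power2_eq_square field_simps)
  finally show ?thesis .
qed

text \<open>The number \<open>37 / 5\<close> is just above the square of \<open>exp 1\<close>. For \<open>N \<le> 3\<close> it is too weak to be used at the
  smallest admissible values of \<open>d\<close>.\<close>

lemma compound_growth_squared:
  assumes "N \<ge> 1"
  shows "((1 + 1 / real N) ^ N)\<^sup>2 \<le> 37 / 5"
    and "N \<le> 3 \<Longrightarrow> ((1 + 1 / real N) ^ N)\<^sup>2 \<le> 6"
proof -
  have "(1 + 1 / real N) ^ N \<le> exp (1 / real N) ^ N"
    by (intro power_mono exp_ge_add_one_self) auto
  also have "\<dots> = exp 1"
    using assms by (simp add: exp_of_nat_mult[symmetric])
  also have "\<dots> \<le> 272 / 100"
    using e_less_272 by simp
  finally have "((1 + 1 / real N) ^ N)\<^sup>2 \<le> (272 / 100)\<^sup>2"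
    by (intro power_mono) auto
  then show "((1 + 1 / real N) ^ N)\<^sup>2 \<le> 37 / 5"
    by (simp add: power2_eq_square)
  assume "N \<le> 3"
  then have "N = 1 \<or> N = 2 \<or> N = 3" using assms by auto
  then show "((1 + 1 / real N) ^ N)\<^sup>2 \<le> 6"
    by (auto simp: power2_eq_square eval_nat_numeral)
qed

text \<open>Here \<open>z + 1\<close> bounds the number of \<open>i\<close> with \<open>i\<^sup>2 < N\<close>, and the right-hand side is \<open>8 * N / d\<close> times
  the sum \<open>\<Sum>i<d. 2 * i\<^sup>2 / N - 1\<close>. For \<open>N \<ge> 4\<close>, since \<open>z\<close> is at most \<open>0.354 * d\<close>, the left-hand side is at most
  about \<open>2.62 * d\<^sup>2 + 7.4 * d\<close>, while the right-hand side is at least about \<open>4.33 * d\<^sup>2 - 8 * d\<close>. This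
  suffices for \<open>d \<ge> 9\<close>; below that and for \<open>N \<le> 3\<close> the value of \<open>z\<close> is known
  exactly enough.\<close>

lemma growth_against_cubic_sum:
  fixes N d z :: nat
  assumes "N \<ge> 1" and z: "z\<^sup>2 < N" and d: "8 * N < d\<^sup>2"
  shows "((1 + 1 / real N) ^ N)\<^sup>2 * (z + 1) * d \<le> 8 / 3 * (real d - 1) * (2 * real d - 1) - 8 * real N"
proof -
  let ?E = "((1 + 1 / real N) ^ N)\<^sup>2"
  have d_gt: "c < d" if "c\<^sup>2 \<le> 8 * N" for c :: nat
    using power2_less_imp_less[of c d] that d by simp
  have z_lt: "z < c" if "N \<le> c\<^sup>2" for c :: nat
    using power2_less_imp_less[of z c] that z by simp
  have step: ?thesis if "?E \<le> e" "z \<le> Z" "e * (Z + 1) * d \<le> 8 / 3 * (real d - 1) * (2 * real d - 1) - 8 * real N"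
    for e :: real and Z :: nat
  proof -
    have "?E * (z + 1) * d \<le> e * (Z + 1) * d"
      using that(1,2) by (intro mult_right_mono mult_mono) (auto intro: order_trans[OF _ that(1)])
    with that(3) show ?thesis by linarith
  qed
  consider "N = 1" | "N = 2 \<or> N = 3" | "N \<ge> 4" using assms(1) by linarith
  then show ?thesis
  proof cases
    case 1
    have "3 \<le> real d" using d_gt[of 2] 1 by simp
    then have "0 \<le> (real d - 3) * (16 * real d + 6)" by simp
    then have "6 * 1 * real d \<le> 8 / 3 * (real d - 1) * (2 * real d - 1) - 8 * 1"
      by (simp add: algebra_simps)
    then show ?thesis
      using z_lt[of 1] compound_growth_squared(2)[of N] 1
      by (intro step[of 6 0]) simp_all
  next
    case 2
    have "d \<ge> 5" using d_gt[of 4] 2 by auto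
    then have d5: "5 \<le> real d" by simp
    then have "0 \<le> (real d - 5) * (16 * real d + 20)" by simp
    then have "6 * 2 * real d \<le> 8 / 3 * (real d - 1) * (2 * real d - 1) - 8 * real N"
      using 2 d5 by (auto simp: algebra_simps)
    then show ?thesis
      using z_lt[of 2] compound_growth_squared(2)[of N] 2
      by (intro step[of 6 1]) auto
  next
    case 3
    have d6: "d \<ge> 6" using d_gt[of 5] 3 by simp
    have N: "8 * real N \<le> real d * real d - 1"
    proof -
      have "8 * N + 1 \<le> d * d" using d by (simp add: power2_eq_square)
      then have "real (8 * N + 1) \<le> real (d * d)" by (simp only: of_nat_le_iff)
      then show ?thesis by simp
    qed
    consider "d = 6" | "d = 7" | "d = 8" | "d \<ge> 9" using d6 by linarith
    then show ?thesis
    proof cases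
      case 1
      then show ?thesis
        using z_lt[of 2] compound_growth_squared(1)[of N] N d assms(1)
        by (intro step[of "37/5" 1]) auto
    next
      case 2
      then show ?thesis
        using z_lt[of 3] compound_growth_squared(1)[of N] N d assms(1)
        by (intro step[of "37/5" 2]) auto
    next
      case 3
      then show ?thesis
        using z_lt[of 3] compound_growth_squared(1)[of N] N d assms(1)
        by (intro step[of "37/5" 2]) auto
    next
      case 4
      \<comment> \<open>The ratio \<open>0.354\<close> is just above \<open>1 / sqrt 8\<close>.\<close>
      have "(1000 * z)\<^sup>2 \<le> (354 * d)\<^sup>2"
        using z d by (simp add: power2_eq_square)
      then have "real z \<le> 354 / 1000 * d"
        using power2_le_imp_le[of "1000 * z" "354 * d"] by simp
      then have "37 / 5 * (real z + 1) \<le> (13 * real d - 24) / 3"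
        using 4 by simp
      then have "37 / 5 * (real z + 1) * d \<le> (13 * real d - 24) / 3 * d"
        by (rule mult_right_mono) simp
      then show ?thesis
        using N compound_growth_squared(1)[OF assms(1)]
        by (intro step[of "37/5" z]) (auto simp: algebra_simps)
    qed
  qed
qed

text \<open>After squaring, the factor \<open>8 * m * N\<close> is obtained where \<open>8 * m\<^sup>2 * N\<close> is allowed, so that \<open>m = 1\<close> is the
  critical case and everything reduces to \<open>growth_against_cubic_sum\<close>.\<close>

lemma numeric_bound:
  fixes N m d :: nat and \<eta> :: real
  assumes "N \<ge> 1" "m \<ge> 1" "0 \<le> \<eta>" and big: "8 * m\<^sup>2 * N < d\<^sup>2"
    and key: "\<eta>\<^sup>2 * (\<Sum>i<d. 2 * (1 / real N) * (real i)\<^sup>2 - 1)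
      \<le> real m * card {i. i < d \<and> 1 / real N * (real i)\<^sup>2 < 1}"
  shows "(1 + 1 / real N) ^ N * \<eta> \<le> real m * sqrt (8 * real N) / real d"
proof -
  define E where "E = (1 + 1 / real N) ^ N"
  define T where "T = (\<Sum>i<d. 2 * (1 / real N) * (real i)\<^sup>2 - 1)"
  \<comment> \<open>The largest \<open>z\<close> with \<open>z\<^sup>2 < N\<close>, written as a minimum.\<close>
  define z where "z = (LEAST z. N \<le> (Suc z)\<^sup>2)"
  have N: "real N > 0" using assms(1) by simp
  have d: "8 * N < d\<^sup>2"
  proof -
    have "8 * 1 * N \<le> 8 * m\<^sup>2 * N" using assms(2) by (intro mult_right_mono) auto
    then show ?thesis using big by linarith
  qed
  then have d0: "d > 0" by (cases d) auto
  have ex: "N \<le> (Suc N)\<^sup>2" by (simp add: power2_eq_square)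
  have z1: "N \<le> (Suc z)\<^sup>2"
    using LeastI[where P = "\<lambda>z. N \<le> (Suc z)\<^sup>2", OF ex] by (simp only: z_def)
  have z2: "z\<^sup>2 < N"
  proof (cases z)
    case 0
    then show ?thesis using assms(1) by simp
  next
    case (Suc y)
    then have "y < (LEAST z. N \<le> (Suc z)\<^sup>2)" using z_def by simp
    from not_less_Least[OF this] show ?thesis using Suc by simp
  qed
  have "{i. i < d \<and> 1 / real N * (real i)\<^sup>2 < 1} \<subseteq> {..<Suc z}"
  proof
    fix i assume "i \<in> {i. i < d \<and> 1 / real N * (real i)\<^sup>2 < 1}"
    then have "(real i)\<^sup>2 < real N" using N by (simp add: field_simps)
    then have "i\<^sup>2 < N" by (metis of_nat_less_iff of_nat_power)
    then have "i\<^sup>2 < (Suc z)\<^sup>2" using z1 by simp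
    then show "i \<in> {..<Suc z}" using power2_less_imp_less by blast
  qed
  then have "card {i. i < d \<and> 1 / real N * (real i)\<^sup>2 < 1} \<le> Suc z"
    using card_mono[of "{..<Suc z}"] by fastforce
  then have "real m * card {i. i < d \<and> 1 / real N * (real i)\<^sup>2 < 1} \<le> real m * (z + 1)"
    by (intro mult_left_mono) auto
  then have key': "\<eta>\<^sup>2 * T \<le> real m * (z + 1)"
    using key unfolding T_def by linarith
  have "E\<^sup>2 * (z + 1) * d * d \<le> (8 / 3 * (real d - 1) * (2 * real d - 1) - 8 * real N) * d"
    using growth_against_cubic_sum[OF assms(1) z2 d] unfolding E_def by (intro mult_right_mono) auto
  also have "\<dots> = 8 * (N * T)"
    using sum_squares_minus_one[OF N, of d] unfolding T_def by (simp add: algebra_simps)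
  finally have cubic: "E\<^sup>2 * (z + 1) * (real d)\<^sup>2 \<le> 8 * N * T"
    by (simp add: power2_eq_square mult.assoc)
  have E: "E > 0" by (simp add: E_def add_pos_nonneg)
  have "0 < E\<^sup>2 * (z + 1) * (real d)\<^sup>2"
    using E d0 by simp
  then have "0 < 8 * N * T" using cubic by linarith
  then have T: "T > 0" using N by (simp add: zero_less_mult_iff)
  have "((E * \<eta> * d)\<^sup>2) * T = E\<^sup>2 * (real d)\<^sup>2 * (\<eta>\<^sup>2 * T)"
    by (simp add: power_mult_distrib)
  also have "\<dots> \<le> E\<^sup>2 * (real d)\<^sup>2 * (real m * (z + 1))"
    by (intro mult_left_mono key') auto
  also have "\<dots> = real m * (E\<^sup>2 * (z + 1) * (real d)\<^sup>2)" by simp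
  also have "\<dots> \<le> real m * (8 * N * T)" by (intro mult_left_mono cubic) simp
  also have "\<dots> \<le> (real m)\<^sup>2 * (8 * N * T)"
    using assms(2) T by (intro mult_right_mono) (auto simp: power2_eq_square)
  finally have "(E * \<eta> * d)\<^sup>2 \<le> (real m)\<^sup>2 * (8 * N)"
    using T by (simp add: mult.assoc[symmetric])
  then have "E * \<eta> * d \<le> sqrt ((real m)\<^sup>2 * (8 * N))"
    by (rule real_le_rsqrt)
  then have "E * \<eta> * d \<le> real m * sqrt (8 * N)"
    by (simp add: real_sqrt_mult)
  then show ?thesis
    using d0 by (simp add: E_def field_simps)
qed

section \<open>The walk discounted at its visits\<close>

text \<open>Observe the path \<open>X\<close> from time \<open>n\<close> on for \<open>K\<close> steps, but not beyond its first visit to level \<open>r\<close>: the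
  predicate says that it visits \<open>L\<close> at most \<open>N\<close> times. The recursion follows the first step of the
  path, so that it matches the Markov property and depends on finitely many coordinates.\<close>

primrec few_visits :: "int set \<Rightarrow> int \<Rightarrow> (nat \<Rightarrow> int \<times> 'v) \<Rightarrow> nat \<Rightarrow> nat \<Rightarrow> nat \<Rightarrow> bool" where
  "few_visits L r X 0 N n = True"
| "few_visits L r X (Suc K) N n =
    (fst (X n) = r \<or>
     (if fst (X n) \<in> L then 0 < N \<and> few_visits L r X K (N - 1) (Suc n)
      else few_visits L r X K N (Suc n)))"

lemma le_hitting_time_iff: "enat n \<le> hitting_time S r \<omega> \<longleftrightarrow> (\<forall>j<n. fst (S j \<omega>) \<noteq> r)"
proof -
  have "enat n \<le> hitting_time S r \<omega> \<longleftrightarrow> (\<forall>j. fst (S j \<omega>) = r \<longrightarrow> n \<le> j)"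
    by (auto simp: hitting_time_def le_INF_iff)
  then show ?thesis using not_le by blast
qed

lemma few_visits_if_card_le:
  assumes "enat n \<le> hitting_time S r \<omega>"
    and "finite {j. n \<le> j \<and> enat j \<le> hitting_time S r \<omega> \<and> fst (S j \<omega>) \<in> L}" (is "finite (?T n)")
    and "card {j. n \<le> j \<and> enat j \<le> hitting_time S r \<omega> \<and> fst (S j \<omega>) \<in> L} \<le> N"
  shows "few_visits L r (\<lambda>i. S i \<omega>) K N n"
  using assms
proof (induction K arbitrary: N n)
  case (Suc K)
  let ?T = "\<lambda>n. {j. n \<le> j \<and> enat j \<le> hitting_time S r \<omega> \<and> fst (S j \<omega>) \<in> L}"
  show ?case
  proof (cases "fst (S n \<omega>) = r")
    case False
    then have n': "enat (Suc n) \<le> hitting_time S r \<omega>"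
      using Suc.prems(1) by (auto simp: le_hitting_time_iff less_Suc_eq)
    have T: "?T n = (if fst (S n \<omega>) \<in> L then insert n (?T (Suc n)) else ?T (Suc n))"
    proof -
      have *: "n \<le> j \<longleftrightarrow> j = n \<or> Suc n \<le> j" for j by auto
      show ?thesis using Suc.prems(1) by (auto simp: *)
    qed
    have fin: "finite (?T (Suc n))"
      by (rule finite_subset[OF _ Suc.prems(2)]) auto
    show ?thesis
    proof (cases "fst (S n \<omega>) \<in> L")
      case True
      then have "Suc (card (?T (Suc n))) \<le> N"
        using Suc.prems(3) T fin by simp
      then show ?thesis
        using True Suc.IH[OF n' fin, of "N - 1"] by auto
    next
      case False
      then show ?thesis
        using Suc.IH[OF n' fin, of N] Suc.prems(3) T by simp
    qed
  qed simp
qed simp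

lemma few_visits_if_time_on_levels_less:
  assumes "ereal_of_enat (time_on_levels S L r \<omega>) < ereal k" and "\<And>c. real c < k \<Longrightarrow> c \<le> N"
  shows "few_visits L r (\<lambda>i. S i \<omega>) K N 0"
proof (rule few_visits_if_card_le)
  let ?T = "{j. enat j \<le> hitting_time S r \<omega> \<and> fst (S j \<omega>) \<in> L}"
  have *: "finite ?T \<and> real (card ?T) < k"
    using assms(1) by (auto simp: time_on_levels_def Let_def split: if_splits)
  then show "finite {j. 0 \<le> j \<and> enat j \<le> hitting_time S r \<omega> \<and> fst (S j \<omega>) \<in> L}" by simp
  show "card {j. 0 \<le> j \<and> enat j \<le> hitting_time S r \<omega> \<and> fst (S j \<omega>) \<in> L} \<le> N"
    using assms(2) * by simp
qed (simp add: zero_enat_def[symmetric])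

context cylinder_subgraph
begin

text \<open>The expected discount, starting from \<open>x\<close>, over the first \<open>K\<close> steps or until level \<open>r\<close> is reached. A walk
  that is still under way after \<open>K\<close> steps counts with the discount it has collected so far;
  this makes the value an upper bound for the discount over the whole walk.\<close>

primrec discounted_value :: "int set \<Rightarrow> int \<Rightarrow> real \<Rightarrow> nat \<Rightarrow> int \<times> 'v \<Rightarrow> real" where
  "discounted_value L r \<kappa> 0 x = 1"
| "discounted_value L r \<kappa> (Suc K) x =
    (if fst x = r then 1
     else (\<Sum>y\<in>nbrs x. discounted_value L r \<kappa> K y) / ((1 + \<kappa> * of_bool (fst x \<in> L)) * deg x))"

lemma discounted_value_nonneg: "\<kappa> > 0 \<Longrightarrow> 0 \<le> discounted_value L r \<kappa> K x"
  by (induction K arbitrary: x) (auto intro!: divide_nonneg_nonneg sum_nonneg)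

lemma discounted_value_decreasing:
  assumes "\<kappa> > 0"
  shows "discounted_value L r \<kappa> (Suc K) x \<le> discounted_value L r \<kappa> K x"
proof (induction K arbitrary: x)
  case 0
  have "1 * real (deg x) \<le> (1 + \<kappa> * of_bool (fst x \<in> L)) * real (deg x)"
    using assms by (intro mult_right_mono) auto
  then show ?case using assms by (auto simp: divide_le_eq_1)
next
  case (Suc K)
  have "(\<Sum>y\<in>nbrs x. discounted_value L r \<kappa> (Suc K) y) \<le> (\<Sum>y\<in>nbrs x. discounted_value L r \<kappa> K y)"
    by (intro sum_mono Suc)
  then show ?case
    using assms by (subst (1 2) discounted_value.simps(2)) (auto intro!: divide_right_mono simp del: discounted_value.simps)
qed

lemma discounted_value_le_1: "\<kappa> > 0 \<Longrightarrow> discounted_value L r \<kappa> K x \<le> 1"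
  using lift_Suc_antimono_le[of "\<lambda>K. discounted_value L r \<kappa> K x" 0 K] discounted_value_decreasing
  by simp

text \<open>The values decrease in \<open>K\<close> and are nonnegative, and their recursion passes to the limit.\<close>

lemma discounted_value_limit:
  assumes "\<kappa> > 0" "finite L" "\<And>\<sigma>. \<sigma> \<in> L \<Longrightarrow> \<sigma> < r"
  obtains h where "\<And>x. (\<lambda>K. discounted_value L r \<kappa> K x) \<longlonglongrightarrow> h x"
    and "killed_harmonic A \<Gamma> L r \<kappa> h"
proof -
  define v where "v = discounted_value L r \<kappa>"
  have v01: "0 \<le> v K x" "v K x \<le> 1" for K x
    using discounted_value_nonneg[OF assms(1)] discounted_value_le_1[OF assms(1)] by (auto simp: v_def)
  have "convergent (\<lambda>K. v K x)" for x
  proof (rule Bseq_monoseq_convergent)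
    show "Bseq (\<lambda>K. v K x)" using v01 by (intro BseqI'[of _ 1]) (simp only: real_norm_def abs_of_nonneg)
    show "monoseq (\<lambda>K. v K x)"
      using discounted_value_decreasing[OF assms(1)] unfolding v_def
      by (intro decseq_imp_monoseq decseq_SucI) auto
  qed
  then obtain h where h: "\<And>x. (\<lambda>K. v K x) \<longlonglongrightarrow> h x"
    unfolding convergent_def by metis
  have "killed_harmonic A \<Gamma> L r \<kappa> h"
  proof unfold_locales
    fix x
    show "0 \<le> h x \<and> h x \<le> 1"
      using LIMSEQ_le_const[OF h[of x], of 0] LIMSEQ_le_const2[OF h[of x], of 1] v01 by blast
    assume x: "x \<in> pverts A" "fst x \<noteq> r"
    let ?c = "(1 + \<kappa> * of_bool (fst x \<in> L)) * real (deg x)"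
    have eq: "?c * v (Suc K) x = (\<Sum>y\<in>nbrs x. v K y)" for K
    proof (cases "nbrs x = {}")
      case False
      moreover have "1 + \<kappa> * of_bool (fst x \<in> L) \<noteq> 0" using assms(1) by auto
      ultimately show ?thesis using x by (simp add: v_def)
    qed simp
    have "(\<lambda>K. ?c * v (Suc K) x) \<longlonglongrightarrow> ?c * h x"
      by (intro tendsto_intros LIMSEQ_Suc h)
    then have "(\<lambda>K. \<Sum>y\<in>nbrs x. v K y) \<longlonglongrightarrow> ?c * h x"
      unfolding eq .
    moreover have "(\<lambda>K. \<Sum>y\<in>nbrs x. v K y) \<longlonglongrightarrow> (\<Sum>y\<in>nbrs x. h y)"
      by (intro tendsto_intros h)
    ultimately show "(\<Sum>y\<in>nbrs x. h y) = ?c * h x"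
      by (rule LIMSEQ_unique[rotated])
  qed (use assms in auto)
  then show thesis by (rule that[OF h[unfolded v_def]])
qed

lemma few_visits_sets:
  assumes "simple_random_walk M A a S"
  shows "{\<omega> \<in> space M. few_visits L r (\<lambda>i. S i \<omega>) K N n} \<in> sets M"
proof (induction K arbitrary: N n)
  case (Suc K)
  have S: "S n \<in> M \<rightarrow>\<^sub>M count_space (pverts A)"
    using assms by (simp add: simple_random_walk_def)
  have level: "{\<omega> \<in> space M. P (fst (S n \<omega>))} \<in> sets M" for P
  proof -
    have eq: "{\<omega> \<in> space M. P (fst (S n \<omega>))} = S n -` {x \<in> pverts A. P (fst x)} \<inter> space M"
      using measurable_space[OF S] by auto
    show ?thesis unfolding eq by (rule measurable_sets[OF S]) auto
  qed
  have "{\<omega> \<in> space M. few_visits L r (\<lambda>i. S i \<omega>) (Suc K) N n} =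
     {\<omega> \<in> space M. fst (S n \<omega>) = r} \<union>
     ({\<omega> \<in> space M. fst (S n \<omega>) \<in> L} \<inter>
       (if 0 < N then {\<omega> \<in> space M. few_visits L r (\<lambda>i. S i \<omega>) K (N - 1) (Suc n)} else {})) \<union>
     ({\<omega> \<in> space M. few_visits L r (\<lambda>i. S i \<omega>) K N (Suc n)} - {\<omega> \<in> space M. fst (S n \<omega>) \<in> L})"
    by auto
  also have "\<dots> \<in> sets M"
    using level[of "\<lambda>l. l = r"] level[of "\<lambda>l. l \<in> L"] Suc by (auto intro!: sets.Un sets.Int sets.Diff)
  finally show ?case .
qed simp

text \<open>A Markov inequality conditioned on the history \<open>x\<close> up to time \<open>n\<close>, with probabilities multiplied
  out. The induction peels off one step of the walk: a visit to \<open>L\<close> lowers the budget \<open>N\<close> by one, which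
  releases a factor \<open>1 + \<kappa>\<close> that is exactly the discount of the current vertex.\<close>

lemma measure_few_visits_history_le:
  assumes walk: "simple_random_walk M A a S" and \<kappa>: "\<kappa> > 0"
    and nbrs: "\<And>x. x \<in> pverts A \<Longrightarrow> nbrs x \<noteq> {}"
  shows "measure M {\<omega> \<in> space M. (\<forall>i\<le>n. S i \<omega> = x i) \<and> few_visits L r (\<lambda>i. S i \<omega>) K N n}
    \<le> measure M {\<omega> \<in> space M. \<forall>i\<le>n. S i \<omega> = x i} * (1 + \<kappa>) ^ N * discounted_value L r \<kappa> K (x n)"
proof (induction K arbitrary: n x N)
  have prob: "prob_space M" and S [measurable]: "\<And>i. S i \<in> M \<rightarrow>\<^sub>M count_space (pverts A)"
    using walk by (auto simp: simple_random_walk_def)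
  interpret prob_space M by (rule prob)
  have in_V: "S i \<omega> \<in> pverts A" if "\<omega> \<in> space M" for i \<omega>
    using measurable_space[OF S that] by simp
  define H where "H n x = {\<omega> \<in> space M. \<forall>i\<le>n. S i \<omega> = x i}" for n x
  define F where "F K N n = {\<omega> \<in> space M. few_visits L r (\<lambda>i. S i \<omega>) K N n}" for K N n
  have H_sets: "H n x \<in> sets M" for n x
  proof -
    have "{\<omega> \<in> space M. S i \<omega> = x i} \<in> sets M" for i
      by measurable
    moreover have "H n x = (\<Inter>i\<in>{..n}. {\<omega> \<in> space M. S i \<omega> = x i})"
      by (auto simp: H_def)
    ultimately show ?thesis by auto
  qed
  have F_sets: "F K N n \<in> sets M" for K N n
    unfolding F_def by (rule few_visits_sets[OF walk])
  have HF: "{\<omega> \<in> space M. (\<forall>i\<le>n. S i \<omega> = x i) \<and> few_visits L r (\<lambda>i. S i \<omega>) K N n} = H n x \<inter> F K N n"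
    for n x K N by (auto simp: H_def F_def)
  have trivial: "measure M (H n x \<inter> F K N n) \<le> measure M (H n x) * (1 + \<kappa>) ^ N * 1" for n x K N
  proof -
    have "measure M (H n x \<inter> F K N n) \<le> measure M (H n x) * 1"
      using finite_measure_mono[OF _ H_sets] by simp
    also have "\<dots> \<le> measure M (H n x) * (1 + \<kappa>) ^ N"
      using \<kappa> by (intro mult_left_mono one_le_power) auto
    finally show ?thesis by simp
  qed
  {
    case 0
    show ?case unfolding HF H_def[symmetric] using trivial by simp
  next
    case (Suc K)
    have IH: "measure M (H n x \<inter> F K N n) \<le> measure M (H n x) * (1 + \<kappa>) ^ N * discounted_value L r \<kappa> K (x n)"
      for n x N
      using Suc unfolding HF H_def[symmetric] .
    \<comment> \<open>Apart from the cases where the event is empty or the value is \<open>1\<close>, the budget left after the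
      current vertex is \<open>N'\<close>.\<close>
    consider "fst (x n) = r" | "x n \<notin> pverts A" | "fst (x n) \<in> L" "N = 0" "fst (x n) \<noteq> r"
      | N' where "fst (x n) \<noteq> r" "x n \<in> pverts A" "N = N' + of_bool (fst (x n) \<in> L)"
    proof (cases "fst (x n) \<in> L \<and> N > 0")
      case True
      then have "N = (N - 1) + of_bool (fst (x n) \<in> L)" by simp
      then show thesis using that by blast
    next
      case False
      then have "N = 0 \<and> fst (x n) \<in> L \<or> N = N + of_bool (fst (x n) \<in> L)" by auto
      then show thesis using that by blast
    qed
    then have "measure M (H n x \<inter> F (Suc K) N n)
      \<le> measure M (H n x) * (1 + \<kappa>) ^ N * discounted_value L r \<kappa> (Suc K) (x n)"
    proof cases
      case 1
      then show ?thesis using trivial by simp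
    next
      case 2
      then have "H n x = {}" using in_V by (auto simp: H_def) (metis order_refl)
      then show ?thesis by simp
    next
      case 3
      then have "H n x \<inter> F (Suc K) N n = {}" by (auto simp: H_def F_def)
      then show ?thesis
        using \<kappa> by (simp only: measure_empty)
          (intro mult_nonneg_nonneg discounted_value_nonneg, auto)
    next
      case 4
      let ?x = "\<lambda>y. x(Suc n := y)" and ?v = "discounted_value L r \<kappa> K"
      let ?p = "pmf (pmf_of_set {w. (x n, w) \<in> parcs A})"
      have Hx: "H (Suc n) (?x y) = {\<omega> \<in> space M. (\<forall>i\<le>n. S i \<omega> = x i) \<and> S (Suc n) \<omega> = y}" for y
        by (auto simp: H_def le_Suc_eq)
      have step: "measure M (H (Suc n) (?x y)) = measure M (H n x) * ?p y" for y
      proof -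
        have "measure M {\<omega> \<in> space M. (\<forall>i\<le>n. S i \<omega> = x i) \<and> S (Suc n) \<omega> = y} =
          measure M {\<omega> \<in> space M. \<forall>i\<le>n. S i \<omega> = x i} * ?p y"
          using walk unfolding simple_random_walk_def by blast
        then show ?thesis by (simp only: Hx) (simp only: H_def)
      qed
      have p: "?p y = of_bool (y \<in> nbrs (x n)) / deg (x n)" for y
        using nbrs[OF 4(2)] finite_nbrs[of "x n"]
        by (simp add: nbrs_def indicator_def of_bool_def)
      have sub: "H n x \<inter> F (Suc K) N n \<subseteq> (\<Union>y\<in>pverts A. H (Suc n) (?x y) \<inter> F K N' (Suc n))"
      proof
        fix \<omega> assume \<omega>: "\<omega> \<in> H n x \<inter> F (Suc K) N n"
        then have "\<omega> \<in> space M" by (simp add: H_def)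
        moreover have "S n \<omega> = x n" using \<omega> by (simp add: H_def)
        then have "few_visits L r (\<lambda>i. S i \<omega>) K N' (Suc n)"
          using \<omega> 4 by (simp add: F_def split: if_splits)
        ultimately have "\<omega> \<in> H (Suc n) (?x (S (Suc n) \<omega>)) \<inter> F K N' (Suc n)"
          using \<omega> unfolding Hx by (auto simp: H_def F_def)
        then show "\<omega> \<in> (\<Union>y\<in>pverts A. H (Suc n) (?x y) \<inter> F K N' (Suc n))"
          using in_V[OF \<open>\<omega> \<in> space M\<close>] by blast
      qed
      have "measure M (H n x \<inter> F (Suc K) N n)
          \<le> measure M (\<Union>y\<in>pverts A. H (Suc n) (?x y) \<inter> F K N' (Suc n))"
        by (intro finite_measure_mono sub sets.finite_UN pair_finite_verts sets.Int H_sets F_sets)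
      also have "\<dots> \<le> (\<Sum>y\<in>pverts A. measure M (H (Suc n) (?x y) \<inter> F K N' (Suc n)))"
        using H_sets F_sets pair_finite_verts by (intro measure_UNION_le) auto
      also have "\<dots> \<le> (\<Sum>y\<in>pverts A. measure M (H n x) * ?p y * (1 + \<kappa>) ^ N' * ?v y)"
        using IH[of "Suc n" "?x _" N'] by (intro sum_mono) (simp add: step)
      also have "\<dots> = measure M (H n x) * (1 + \<kappa>) ^ N' / deg (x n) * (\<Sum>y\<in>pverts A. of_bool (y \<in> nbrs (x n)) * ?v y)"
        unfolding p by (simp add: sum_distrib_left mult_ac del: sum_of_bool_mult_eq sum_mult_of_bool_eq)
      also have "(\<Sum>y\<in>pverts A. of_bool (y \<in> nbrs (x n)) * ?v y) = (\<Sum>y\<in>nbrs (x n). ?v y)"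
        using nbrs_in_verts[of _ "x n"]
        by (intro sum.mono_neutral_cong_right) (auto simp: pair_finite_verts simp del: split_paired_All)
      also have "measure M (H n x) * (1 + \<kappa>) ^ N' / deg (x n) * (\<Sum>y\<in>nbrs (x n). ?v y)
          = measure M (H n x) * (1 + \<kappa>) ^ N * discounted_value L r \<kappa> (Suc K) (x n)"
      proof (cases "fst (x n) \<in> L")
        case True
        define c where "c = 1 + \<kappa>"
        then have "c \<noteq> 0" using \<kappa> by simp
        then show ?thesis using True 4 by (simp flip: c_def)
      next
        case False
        then show ?thesis using 4 by simp
      qed
      finally show ?thesis .
    qed
    then show ?case unfolding HF H_def[symmetric] .
  }
qed

lemma measure_few_visits_le:
  assumes walk: "simple_random_walk M A a S" and \<kappa>: "\<kappa> > 0"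
    and nbrs: "\<And>x. x \<in> pverts A \<Longrightarrow> nbrs x \<noteq> {}"
    and E: "\<And>\<omega> K. \<omega> \<in> E \<Longrightarrow> \<omega> \<in> space M \<and> few_visits L r (\<lambda>i. S i \<omega>) K N 0"
  shows "measure M E \<le> (1 + \<kappa>) ^ N * discounted_value L r \<kappa> K a"
proof -
  interpret prob_space M using walk by (simp add: simple_random_walk_def)
  have S: "S 0 \<in> M \<rightarrow>\<^sub>M count_space (pverts A)" and start: "AE \<omega> in M. S 0 \<omega> = a"
    using walk by (auto simp: simple_random_walk_def)
  let ?B = "{\<omega> \<in> space M. (\<forall>i\<le>0. S i \<omega> = (\<lambda>_. a) i) \<and> few_visits L r (\<lambda>i. S i \<omega>) K N 0}"
  have "?B = S 0 -` {x \<in> pverts A. x = a} \<inter> space M \<inter> {\<omega> \<in> space M. few_visits L r (\<lambda>i. S i \<omega>) K N 0}"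
    using measurable_space[OF S] by auto
  also have "\<dots> \<in> sets M"
    by (intro sets.Int few_visits_sets[OF walk] measurable_sets[OF S]) auto
  finally have "measure M E \<le> measure M ?B"
    using start E by (intro finite_measure_mono_AE) auto
  also have "\<dots> \<le> measure M {\<omega> \<in> space M. \<forall>i\<le>0. S i \<omega> = (\<lambda>_. a) i} * (1 + \<kappa>) ^ N * discounted_value L r \<kappa> K a"
    by (rule measure_few_visits_history_le[OF walk \<kappa> nbrs])
  also have "\<dots> \<le> 1 * (1 + \<kappa>) ^ N * discounted_value L r \<kappa> K a"
    using \<kappa> by (intro mult_right_mono discounted_value_nonneg prob_le_1) auto
  finally show ?thesis by simp
qed

end

section \<open>Few visits are unlikely\<close>

theorem proposition2p9:
  fixes \<Gamma> :: "'v pair_pre_digraph"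
    and A :: "(int \<times> 'v) pair_pre_digraph"
    and a :: "int \<times> 'v"
    and d :: nat
    and s :: "nat \<Rightarrow> int"
    and r :: int
    and M :: "'w measure"
    and S :: "nat \<Rightarrow> 'w \<Rightarrow> int \<times> 'v"
    and k :: real
  assumes "pair_graph \<Gamma>" and "connected \<Gamma>"
    and "pair_graph A" and "connected A" and "subgraph A (Z_times \<Gamma>)"
    and "a \<in> pverts A"
    and "d \<ge> 1"
    and "fst a < s 1" and "strict_mono_on {1..d} s" and "s d < r"
    and "pverts A \<inter> ({r} \<times> pverts \<Gamma>) \<noteq> {}"
    and "simple_random_walk M A a S"
    and "k \<ge> 1"
  shows "measure M {\<omega> \<in> space M. ereal_of_enat (time_on_levels S (s ` {1..d}) r \<omega>) < ereal k}
    \<le> real (card (pverts \<Gamma>)) * sqrt (8 * k) / real d"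
proof -
  interpret cylinder_subgraph A \<Gamma>
    using assms by (simp add: cylinder_subgraph_def cylinder_subgraph_axioms_def)
  interpret G: pair_graph \<Gamma> by fact
  interpret M: prob_space M using assms by (simp add: simple_random_walk_def)
  define L where "L = s ` {1..d}"
  define m where "m = card (pverts \<Gamma>)"
  define E where "E = {\<omega> \<in> space M. ereal_of_enat (time_on_levels S L r \<omega>) < ereal k}"
  \<comment> \<open>The largest integer below \<open>k\<close>, raised to \<open>1\<close> for \<open>k = 1\<close> so that \<open>1 / N\<close> makes sense. It
    stays at most \<open>k\<close>.\<close>
  define N where "N = max 1 (nat (\<lceil>k\<rceil> - 1))"
  have N1: "N \<ge> 1" and Nk: "real N \<le> k"
    using assms(13) by (auto simp: N_def) linarith
  have below_k: "c \<le> N" if "real c < k" for c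
  proof -
    have "int c < \<lceil>k\<rceil>" using that by (simp add: less_ceiling_iff)
    then show ?thesis by (simp add: N_def)
  qed
  obtain b where b: "b \<in> pverts A" "fst b = r" "snd b \<in> pverts \<Gamma>"
    using assms(11) by force
  then have m1: "m \<ge> 1"
    using G.pair_finite_verts by (auto simp: m_def Suc_le_eq card_gt_0_iff)
  have mono: "s i \<le> s j" if "1 \<le> i" "i \<le> j" "j \<le> d" for i j
    using strict_mono_onD[OF assms(9), of i j] that by (cases "i = j") auto
  have above_a: "fst a < \<sigma>" and below_r: "\<sigma> < r" if "\<sigma> \<in> L" for \<sigma>
    using that mono[of 1] mono[of _ d] assms(8,10) by (fastforce simp: L_def)+
  have card_L: "card L = d" and fin_L: "finite L"
    using card_image[OF strict_mono_on_imp_inj_on[OF assms(9)]] by (auto simp: L_def)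
  have "s 1 \<in> L" using assms(7) by (auto simp: L_def)
  then have "a \<noteq> b" using above_a below_r b by force
  then have nbrs: "nbrs x \<noteq> {}" if "x \<in> pverts A" for x
    using nbrs_nonempty[OF that] b(1) assms(6) by blast
  have "measure M E \<le> m * sqrt (8 * real N) / d"
  proof (cases "8 * m\<^sup>2 * N < d\<^sup>2")
    case False
    \<comment> \<open>Here the claimed bound is at least \<open>1\<close>.\<close>
    then have "real (d\<^sup>2) \<le> real (8 * m\<^sup>2 * N)" by (simp only: not_less of_nat_le_iff)
    then have "real d \<le> sqrt (8 * m\<^sup>2 * N)" by (intro real_le_rsqrt) simp
    also have "\<dots> = m * sqrt (8 * real N)" by (simp add: real_sqrt_mult)
    finally have "1 \<le> m * sqrt (8 * real N) / d" using assms(7) by (simp add: le_divide_eq_1)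
    then show ?thesis using M.prob_le_1[of E] by linarith
  next
    case True
    define \<kappa> where "\<kappa> = 1 / real N"
    have \<kappa>: "\<kappa> > 0" using N1 by (simp add: \<kappa>_def)
    obtain h where h: "\<And>x. (\<lambda>K. discounted_value L r \<kappa> K x) \<longlonglongrightarrow> h x"
      and "killed_harmonic A \<Gamma> L r \<kappa> h"
      using discounted_value_limit[OF \<kappa> fin_L below_r] by blast
    then interpret H: killed_harmonic A \<Gamma> L r \<kappa> h by simp
    have "measure M E \<le> (1 + \<kappa>) ^ N * discounted_value L r \<kappa> K a" for K
    proof (rule measure_few_visits_le[OF assms(12) \<kappa> nbrs])
      fix \<omega> K
      assume "\<omega> \<in> E"
      then show "\<omega> \<in> space M \<and> few_visits L r (\<lambda>i. S i \<omega>) K N 0"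
        by (auto simp: E_def intro: few_visits_if_time_on_levels_less[OF _ below_k])
    qed
    moreover have "(\<lambda>K. (1 + \<kappa>) ^ N * discounted_value L r \<kappa> K a) \<longlonglongrightarrow> (1 + \<kappa>) ^ N * h a"
      by (intro tendsto_intros h)
    ultimately have "measure M E \<le> (1 + \<kappa>) ^ N * h a"
      by (intro LIMSEQ_le_const) auto
    also have "\<dots> \<le> m * sqrt (8 * real N) / d"
    proof (rule numeric_bound[OF N1 m1 _ True, of "h a", folded \<kappa>_def])
      show "(h a)\<^sup>2 * (\<Sum>i<d. 2 * \<kappa> * (real i)\<^sup>2 - 1) \<le> m * real (card {i. i < d \<and> \<kappa> * (real i)\<^sup>2 < 1})"
        using H.decay_bound[of a b] assms(6) above_a b by (simp add: card_L m_def)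
    qed (use H.h_range in blast)
    finally show ?thesis .
  qed
  also have "\<dots> \<le> m * sqrt (8 * k) / d"
    using Nk by (intro divide_right_mono mult_left_mono real_sqrt_le_mono) auto
  finally show ?thesis by (simp add: E_def L_def m_def)
qed

end
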